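(* The problem (BMFNI) is intractable even on two-terminal parallel graphs, i.e. the number of non-dominated points might be exponential in the size of the problem instance; in fact, even the number of supported non-dominated points might be exponential in the size of the problem instance. Precisely: there exist a constant $\kappa>0$, a polynomial $p$, and a sequence of (BMFNI) instances $(G_n,u_n,c_n,B_n)$, $n\in\mathbb{N}$, $n\ge 1$, in which every $G_n$ is a two-terminal parallel graph, such that the binary encoding length of the $n$-th instance is at most $p(n)$, while for all sufficiently large $n$ the number of supported non-dominated points (and hence the number of non-dominated points) of the $n$-th instance is at least $2^{\kappa n}$.
   Context: $\mathbb{N}$ includes $0$. Graphs are directed and parallel arcs are allowed. An instance $(G,u,c,B)$ of the biobjective maximum flow network interdiction problem (BMFNI) consists of a directed graph $G=(V,A)$ with $m=|A|$ arcs, a source $s\in V$ and a sink $t\in V$, $s\neq t$, two arc capacity functions $u=(u^1,u^2)\colon A\to\mathbb{N}^2$, interdiction costs $c(a)\in\mathbb{N}$ for $a\in A$, and an interdiction budget $B\in\mathbb{N}$. The set of feasible interdiction strategies is $\Gamma=\{\gamma=(\gamma_a)_{a\in A}\in\{0,1\}^m \mid \sum_{a\in A}c(a)\gamma_a\leq B\}$. For $\gamma\in\Gamma$, let $A(\gamma)=\{a\in A\mid\gamma_a=1\}$ be the set of interdicted arcs and $G(\gamma)=(V,A\setminus A(\gamma))$ the interdicted graph. For a capacity function $w$, $\mathrm{VAL}(G(\gamma),w)$ is the maximum value of an $s$-$t$-flow in $G(\gamma)$ with respect to the capacities $w$, and $\mathrm{VAL}(G(\gamma),u)=(\mathrm{VAL}(G(\gamma),u^1),\mathrm{VAL}(G(\gamma),u^2))$.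 For $y,z\in\mathbb{N}^2$, $y\leq z$ means $y_k\leq z_k$ for $k=1,2$ and $y\neq z$. A strategy $\gamma\in\Gamma$ is efficient if there is no $\gamma'\in\Gamma$ with $\mathrm{VAL}(G(\gamma'),u)\leq\mathrm{VAL}(G(\gamma),u)$; in this case $\mathrm{VAL}(G(\gamma),u)$ is called a non-dominated point. A non-dominated point $y$ is supported if there are weights $\lambda_1,\lambda_2>0$ such that $y$ minimizes $\lambda_1 z_1+\lambda_2 z_2$ over all $z\in\{\mathrm{VAL}(G(\gamma),u)\mid\gamma\in\Gamma\}$. A two-terminal parallel graph is a directed graph with vertex set $V=\{s,t\}$ whose $m$ arcs are all parallel arcs from $s$ to $t$. *)

theory Defs
  imports
    Complex_Main
    "HOL-Library.FuncSet"
    "HOL-Library.Log_Nat"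
    "HOL-Computational_Algebra.Polynomial"
    "Graph_Theory.Digraph"
begin

definition is_flow ::
  "('v, 'a) pre_digraph \<Rightarrow> 'v \<Rightarrow> 'v \<Rightarrow> ('a \<Rightarrow> nat) \<Rightarrow> ('a \<Rightarrow> real) \<Rightarrow> bool" where
  "is_flow G s t w f \<longleftrightarrow>
     (\<forall>a\<in>arcs G. 0 \<le> f a \<and> f a \<le> real (w a)) \<and>
     (\<forall>v\<in>verts G - {s, t}. (\<Sum>a\<in>in_arcs G v. f a) = (\<Sum>a\<in>out_arcs G v. f a))"

definition flow_value :: "('v, 'a) pre_digraph \<Rightarrow> 'v \<Rightarrow> ('a \<Rightarrow> real) \<Rightarrow> real" where
  "flow_value G s f = (\<Sum>a\<in>out_arcs G s. f a) - (\<Sum>a\<in>in_arcs G s. f a)"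

text \<open>On a finite graph the maximum is attained, by compactness of the set of flows on the arcs,
  and it is a natural number, by integrality of the capacities.\<close>

definition VAL ::
  "('v, 'a) pre_digraph \<Rightarrow> 'v \<Rightarrow> 'v \<Rightarrow> ('a \<Rightarrow> nat) \<Rightarrow> real" where
  "VAL G s t w = (GREATEST r. \<exists>f. is_flow G s t w f \<and> r = flow_value G s f)"

record ('v, 'a) bmfni =
  graph :: "('v, 'a) pre_digraph"
  source :: 'v
  sink :: 'v
  cap1 :: "'a \<Rightarrow> nat"
  cap2 :: "'a \<Rightarrow> nat"
  cost :: "'a \<Rightarrow> nat"
  budget :: nat

text \<open>The locale \<open>fin_digraph\<close> allows parallel arcs and loops.\<close>

definition bmfni_instance :: "('v, 'a) bmfni \<Rightarrow> bool" where
  "bmfni_instance I \<longleftrightarrow>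
     fin_digraph (graph I) \<and> source I \<in> verts (graph I) \<and> sink I \<in> verts (graph I) \<and>
     source I \<noteq> sink I"

definition two_terminal_parallel :: "('v, 'a) pre_digraph \<Rightarrow> 'v \<Rightarrow> 'v \<Rightarrow> bool" where
  "two_terminal_parallel G s t \<longleftrightarrow>
     verts G = {s, t} \<and> (\<forall>a\<in>arcs G. tail G a = s \<and> head G a = t)"

definition strategies :: "('v, 'a) bmfni \<Rightarrow> ('a \<Rightarrow> nat) set" where
  "strategies I =
     {\<gamma> \<in> arcs (graph I) \<rightarrow>\<^sub>E {0, 1}. (\<Sum>a\<in>arcs (graph I). cost I a * \<gamma> a) \<le> budget I}"

definition interdicted_graph :: "('v, 'a) pre_digraph \<Rightarrow> ('a \<Rightarrow> nat) \<Rightarrow> ('v, 'a) pre_digraph" where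
  "interdicted_graph G \<gamma> = G\<lparr>arcs := arcs G - {a \<in> arcs G. \<gamma> a = 1}\<rparr>"

definition VAL_point :: "('v, 'a) bmfni \<Rightarrow> ('a \<Rightarrow> nat) \<Rightarrow> real \<times> real" where
  "VAL_point I \<gamma> =
     (VAL (interdicted_graph (graph I) \<gamma>) (source I) (sink I) (cap1 I),
      VAL (interdicted_graph (graph I) \<gamma>) (source I) (sink I) (cap2 I))"

definition dominates :: "real \<times> real \<Rightarrow> real \<times> real \<Rightarrow> bool" where
  "dominates y z \<longleftrightarrow> fst y \<le> fst z \<and> snd y \<le> snd z \<and> y \<noteq> z"

definition efficient :: "('v, 'a) bmfni \<Rightarrow> ('a \<Rightarrow> nat) \<Rightarrow> bool" where
  "efficient I \<gamma> \<longleftrightarrow>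
     \<gamma> \<in> strategies I \<and> \<not> (\<exists>\<gamma>'\<in>strategies I. dominates (VAL_point I \<gamma>') (VAL_point I \<gamma>))"

definition nondominated_points :: "('v, 'a) bmfni \<Rightarrow> (real \<times> real) set" where
  "nondominated_points I = {VAL_point I \<gamma> |\<gamma>. efficient I \<gamma>}"

definition supported_nondominated_points :: "('v, 'a) bmfni \<Rightarrow> (real \<times> real) set" where
  "supported_nondominated_points I =
     {y \<in> nondominated_points I.
        \<exists>l1 l2 :: real. l1 > 0 \<and> l2 > 0 \<and>
          (\<forall>z\<in>VAL_point I ` strategies I. l1 * fst y + l2 * snd y \<le> l1 * fst z + l2 * snd z)}"

text \<open>Number of binary digits, where \<open>0\<close> is written with one digit.\<close>

definition bits :: "nat \<Rightarrow> nat" where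
  "bits k = max 1 (floorlog 2 k)"

text \<open>The vertices are numbered consecutively, so that naming a vertex takes at most
  \<open>bits |V|\<close> digits. The encoding lists the vertices, the source, the sink, for each arc its two
  end vertices, its two capacities and its cost, and finally the budget.\<close>

definition encoding_length :: "('v, 'a) bmfni \<Rightarrow> nat" where
  "encoding_length I =
     (let G = graph I; b = bits (card (verts G)) in
        card (verts G) * b + 2 * b +
        (\<Sum>a\<in>arcs G. 2 * b + bits (cap1 I a) + bits (cap2 I a) + bits (cost I a)) +
        bits (budget I))"

end

theory Submission
  imports Defs
begin

text \<open>On a two-terminal parallel graph every arc can be saturated independently, so interdicting
  \<open>\<gamma>\<close> leaves in each objective exactly the total capacity of the arcs that survive, and the problem
  is a biobjective knapsack problem. Suppose that interdicting an arc costs as much as the sum of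
  its two capacities. Then the sum of the two objectives drops by exactly the cost that is spent,
  hence by at most the budget, and every strategy that exhausts the budget minimizes the objective
  with weights \<open>(1, 1)\<close>: its image is a supported non-dominated point
  (\<open>budget_exhausting_imp_supported\<close>).

  It remains to exhaust the budget in exponentially many ways with different images. For each
  \<open>i < n\<close> take one arc with capacities \<open>(2\<^sup>i, 0)\<close> and one with capacities \<open>(0, 2\<^sup>i)\<close>, both of
  cost \<open>2\<^sup>i\<close>, and let the budget be \<open>2\<^sup>n - 1\<close>. Interdicting exactly one arc of each pair exhausts the
  budget. Reading the choices as the binary digits of a number \<open>k < 2\<^sup>n\<close>, the resulting point
  is \<open>(2\<^sup>n - 1 - k, k)\<close>, so all \<open>2\<^sup>n\<close> choices give different points, while the numbers in
  the instance have at most \<open>n\<close> digits. All these points lie on one line,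
  so they are supported by the same weights, and only the two ends of the line are extreme.\<close>

section \<open>Interdiction on parallel arcs as a knapsack problem\<close>

lemma VAL_parallel:
  assumes "finite (arcs G)" "two_terminal_parallel G s t" "s \<noteq> t"
  shows "VAL G s t w = (\<Sum>a\<in>arcs G. real (w a))"
proof -
  have out: "out_arcs G s = arcs G" and "in": "in_arcs G s = {}"
    using assms by (auto simp: two_terminal_parallel_def out_arcs_def in_arcs_def)
  have val: "flow_value G s f = (\<Sum>a\<in>arcs G. f a)" for f
    by (simp add: flow_value_def out "in")
  have flow: "is_flow G s t w f \<longleftrightarrow> (\<forall>a\<in>arcs G. 0 \<le> f a \<and> f a \<le> real (w a))" for f
    using assms(2) by (auto simp: is_flow_def two_terminal_parallel_def)
  show ?thesis unfolding VAL_def val flow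
    by (rule Greatest_equality) (auto intro!: sum_mono exI[of _ "\<lambda>a. real (w a)"])
qed

lemma VAL_interdicted_parallel:
  assumes I: "bmfni_instance I" "two_terminal_parallel (graph I) (source I) (sink I)"
    and \<gamma>: "\<gamma> \<in> strategies I"
  shows "VAL (interdicted_graph (graph I) \<gamma>) (source I) (sink I) w =
    real (\<Sum>a\<in>arcs (graph I). w a) - real (\<Sum>a\<in>arcs (graph I). w a * \<gamma> a)"
proof -
  let ?A = "arcs (graph I)" and ?H = "interdicted_graph (graph I) \<gamma>"
  have fin: "finite ?A" and st: "source I \<noteq> sink I"
    using I(1) by (auto simp: bmfni_instance_def fin_digraph_def fin_digraph_axioms_def)
  have arcs: "arcs ?H = ?A - {a \<in> ?A. \<gamma> a = 1}"
    by (simp add: interdicted_graph_def)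
  have \<gamma>01: "\<gamma> a = 0 \<or> \<gamma> a = 1" if "a \<in> ?A" for a
    using \<gamma> that by (auto simp: strategies_def PiE_def Pi_def)
  have "two_terminal_parallel ?H (source I) (sink I)"
    using I(2) by (auto simp: two_terminal_parallel_def interdicted_graph_def)
  then have "VAL ?H (source I) (sink I) w = (\<Sum>a\<in>?A - {a \<in> ?A. \<gamma> a = 1}. real (w a))"
    using VAL_parallel[of ?H] fin st by (simp add: arcs)
  also have "\<dots> = (\<Sum>a\<in>?A. real (w a) - real (w a * \<gamma> a))"
    by (intro sum.mono_neutral_cong_left) (auto simp: fin dest: \<gamma>01)
  finally show ?thesis by (simp add: sum_subtractf)
qed

section \<open>Strategies that exhaust the budget\<close>

lemma min_sum_imp_supported:
  assumes \<gamma>: "\<gamma> \<in> strategies I"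
    and min: "\<And>\<gamma>'. \<gamma>' \<in> strategies I \<Longrightarrow>
      fst (VAL_point I \<gamma>) + snd (VAL_point I \<gamma>) \<le> fst (VAL_point I \<gamma>') + snd (VAL_point I \<gamma>')"
  shows "VAL_point I \<gamma> \<in> supported_nondominated_points I"
proof -
  have "\<not> dominates (VAL_point I \<gamma>') (VAL_point I \<gamma>)" if "\<gamma>' \<in> strategies I" for \<gamma>'
    using min[OF that] by (auto simp: dominates_def prod_eq_iff)
  then have "VAL_point I \<gamma> \<in> nondominated_points I"
    using \<gamma> by (auto simp: nondominated_points_def efficient_def)
  then show ?thesis
    using min by (auto simp: supported_nondominated_points_def intro!: exI[of _ "1::real"])
qed

text \<open>Each unit of cost that is spent lowers the sum of the two objectives by one, so no strategy
  lowers it by more than the budget.\<close>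

lemma budget_exhausting_imp_supported:
  assumes I: "bmfni_instance I" "two_terminal_parallel (graph I) (source I) (sink I)"
    and cost: "\<And>a. a \<in> arcs (graph I) \<Longrightarrow> cost I a = cap1 I a + cap2 I a"
    and \<gamma>: "\<gamma> \<in> strategies I"
    and exhaust: "(\<Sum>a\<in>arcs (graph I). cost I a * \<gamma> a) = budget I"
  shows "VAL_point I \<gamma> \<in> supported_nondominated_points I"
proof (rule min_sum_imp_supported[OF \<gamma>])
  let ?A = "arcs (graph I)"
  have total: "fst (VAL_point I \<delta>) + snd (VAL_point I \<delta>) =
      real (\<Sum>a\<in>?A. cap1 I a) + real (\<Sum>a\<in>?A. cap2 I a) - real (\<Sum>a\<in>?A. cost I a * \<delta> a)"
    if "\<delta> \<in> strategies I" for \<delta>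
  proof -
    have "(\<Sum>a\<in>?A. cost I a * \<delta> a) = (\<Sum>a\<in>?A. cap1 I a * \<delta> a) + (\<Sum>a\<in>?A. cap2 I a * \<delta> a)"
      by (simp add: cost sum.distrib[symmetric] distrib_right)
    then have "real (\<Sum>a\<in>?A. cost I a * \<delta> a) =
        real (\<Sum>a\<in>?A. cap1 I a * \<delta> a) + real (\<Sum>a\<in>?A. cap2 I a * \<delta> a)"
      by (simp only: of_nat_add)
    then show ?thesis
      unfolding VAL_point_def fst_conv snd_conv VAL_interdicted_parallel[OF I that] by linarith
  qed
  fix \<gamma>' assume \<gamma>': "\<gamma>' \<in> strategies I"
  then have "(\<Sum>a\<in>?A. cost I a * \<gamma>' a) \<le> (\<Sum>a\<in>?A. cost I a * \<gamma> a)"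
    unfolding exhaust by (simp add: strategies_def)
  then have "real (\<Sum>a\<in>?A. cost I a * \<gamma>' a) \<le> real (\<Sum>a\<in>?A. cost I a * \<gamma> a)"
    by (simp only: of_nat_le_iff)
  then show "fst (VAL_point I \<gamma>) + snd (VAL_point I \<gamma>)
      \<le> fst (VAL_point I \<gamma>') + snd (VAL_point I \<gamma>')"
    unfolding total[OF \<gamma>] total[OF \<gamma>'] by linarith
qed

lemma finite_nondominated_points:
  assumes "bmfni_instance I"
  shows "finite (nondominated_points I)"
proof -
  have "finite (arcs (graph I) \<rightarrow>\<^sub>E {0, 1 :: nat})"
    using assms
    by (intro finite_PiE) (auto simp: bmfni_instance_def fin_digraph_def fin_digraph_axioms_def)
  then have "finite (strategies I)"
    unfolding strategies_def by (rule rev_finite_subset) auto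
  moreover have "nondominated_points I \<subseteq> VAL_point I ` strategies I"
    by (auto simp: nondominated_points_def efficient_def)
  ultimately show ?thesis by (blast intro: finite_surj)
qed

section \<open>Pairs of arcs with powers of two as capacities\<close>

text \<open>Arc \<open>i < n\<close> contributes to the first objective and is paired with arc \<open>n + i\<close>, which contributes
  the same amount to the second one.\<close>

definition binary_instance :: "nat \<Rightarrow> (nat, nat) bmfni" where
  "binary_instance n =
    \<lparr>graph = \<lparr>verts = {0, 1}, arcs = {..<n + n}, tail = (\<lambda>_. 0), head = (\<lambda>_. 1)\<rparr>,
     source = 0, sink = 1,
     cap1 = (\<lambda>a. if a < n then 2 ^ a else 0),
     cap2 = (\<lambda>a. if a < n then 0 else 2 ^ (a - n)),
     cost = (\<lambda>a. if a < n then 2 ^ a else 2 ^ (a - n)),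
     budget = 2 ^ n - 1\<rparr>"

definition digit_strategy :: "nat \<Rightarrow> nat \<Rightarrow> nat \<Rightarrow> nat" where
  "digit_strategy n k =
    (\<lambda>a\<in>{..<n + n}. of_bool (if a < n then bit k a else \<not> bit k (a - n)))"

lemma binary_instance_parallel:
  "bmfni_instance (binary_instance n)"
  "two_terminal_parallel (graph (binary_instance n))
    (source (binary_instance n)) (sink (binary_instance n))"
  by (auto simp: binary_instance_def bmfni_instance_def two_terminal_parallel_def
      intro!: fin_digraph.intro wf_digraph.intro fin_digraph_axioms.intro)

lemma sum_lessThan_add:
  fixes f :: "nat \<Rightarrow> 'a::comm_monoid_add"
  shows "(\<Sum>a<n + m. f a) = (\<Sum>i<n. f i) + (\<Sum>i<m. f (n + i))"
  by (induction m) (simp_all add: add.assoc)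

lemma sum_power2_lessThan: "(\<Sum>i<n. 2 ^ i :: nat) = 2 ^ n - 1"
  unfolding lessThan_def by (rule mask_eq_sum_exp[symmetric])

lemma sum_binary_digits:
  assumes "k < 2 ^ n"
  shows "(\<Sum>i<n. 2 ^ i * of_bool (bit k i)) = (k :: nat)"
proof -
  have "k = take_bit n k"
    using assms by (simp add: take_bit_nat_eq_self)
  also have "\<dots> = (\<Sum>i<n. 2 ^ i * of_bool (bit k i))"
    unfolding take_bit_sum push_bit_eq_mult atLeast0LessThan by (simp only: mult.commute)
  finally show ?thesis by (rule sym)
qed

lemma sum_complementary_binary_digits:
  assumes "k < 2 ^ n"
  shows "(\<Sum>i<n. 2 ^ i * of_bool (\<not> bit k i)) = (2 ^ n - 1 - k :: nat)"
proof -
  have "(\<Sum>i<n. 2 ^ i * of_bool (\<not> bit k i)) + (\<Sum>i<n. 2 ^ i * of_bool (bit k i))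
      = (\<Sum>i<n. 2 ^ i :: nat)"
    unfolding sum.distrib[symmetric] by (rule sum.cong) auto
  then show ?thesis
    using sum_binary_digits[OF assms] sum_power2_lessThan[of n] by linarith
qed

text \<open>The digits \<open>1\<close> of \<open>k\<close> select arcs of total cost \<open>k\<close> and the digits \<open>0\<close> select the partners of
  the other arcs, of total cost \<open>2\<^sup>n - 1 - k\<close>.\<close>

lemma digit_strategy_exhausts_budget:
  assumes "k < 2 ^ n"
  shows "(\<Sum>a\<in>arcs (graph (binary_instance n)). cost (binary_instance n) a * digit_strategy n k a) =
    budget (binary_instance n)"
  using assms sum_binary_digits[OF assms] sum_complementary_binary_digits[OF assms]
  by (simp add: binary_instance_def digit_strategy_def sum_lessThan_add)

lemma digit_strategy_in_strategies:
  assumes "k < 2 ^ n"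
  shows "digit_strategy n k \<in> strategies (binary_instance n)"
  using digit_strategy_exhausts_budget[OF assms]
  by (auto simp: strategies_def) (auto simp: digit_strategy_def binary_instance_def)

lemma VAL_point_digit_strategy:
  assumes "k < 2 ^ n"
  shows "VAL_point (binary_instance n) (digit_strategy n k) = (real (2 ^ n - 1 - k), real k)"
proof -
  let ?I = "binary_instance n" and ?\<gamma> = "digit_strategy n k"
  let ?A = "arcs (graph ?I)"
  have "(\<Sum>a\<in>?A. cap1 ?I a) = 2 ^ n - 1" "(\<Sum>a\<in>?A. cap1 ?I a * ?\<gamma> a) = k"
    "(\<Sum>a\<in>?A. cap2 ?I a) = 2 ^ n - 1" "(\<Sum>a\<in>?A. cap2 ?I a * ?\<gamma> a) = 2 ^ n - 1 - k"
    using sum_binary_digits[OF assms] sum_complementary_binary_digits[OF assms]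
    by (simp_all add: binary_instance_def digit_strategy_def sum_lessThan_add
        sum_power2_lessThan)
  moreover have "k \<le> 2 ^ n - 1" using assms by simp
  ultimately show ?thesis
    unfolding VAL_point_def VAL_interdicted_parallel[OF binary_instance_parallel
        digit_strategy_in_strategies[OF assms]]
    by (simp only: of_nat_diff[symmetric] diff_le_self diff_diff_cancel)
qed

lemma card_supported_binary_instance:
  "2 ^ n \<le> card (supported_nondominated_points (binary_instance n))"
proof -
  let ?I = "binary_instance n" and ?f = "\<lambda>k. VAL_point (binary_instance n) (digit_strategy n k)"
  have cost: "cost ?I a = cap1 ?I a + cap2 ?I a" for a
    by (simp add: binary_instance_def)
  have "?f ` {..<2 ^ n} \<subseteq> supported_nondominated_points ?I"
    using budget_exhausting_imp_supported[OF binary_instance_parallel cost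
        digit_strategy_in_strategies digit_strategy_exhausts_budget] by blast
  moreover have "inj_on ?f {..<2 ^ n}"
    by (rule inj_onI) (simp add: VAL_point_digit_strategy)
  moreover have "finite (supported_nondominated_points ?I)"
    using finite_nondominated_points[OF binary_instance_parallel(1)]
    by (rule rev_finite_subset) (auto simp: supported_nondominated_points_def)
  ultimately show ?thesis
    using card_inj_on_le[of ?f "{..<2 ^ n}"] by simp
qed

lemma bits_le:
  assumes "k < 2 ^ n" "n \<ge> 1"
  shows "bits k \<le> n"
  using assms floorlog_leI[of k 2 n] by (simp add: bits_def)

text \<open>The two vertices and the two terminals take at most \<open>8\<close> digits, the budget \<open>n\<close>, and each of
  the \<open>2 n\<close> arcs at most \<open>4\<close> for its ends and \<open>3 n\<close> for its capacities and cost.\<close>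

lemma encoding_length_binary_instance:
  assumes "n \<ge> 1"
  shows "encoding_length (binary_instance n) \<le> 8 + 9 * n + 6 * n\<^sup>2"
proof -
  let ?I = "binary_instance n"
  have b: "bits 2 \<le> 2" by (rule bits_le) auto
  have "bits (cap1 ?I a) \<le> n \<and> bits (cap2 ?I a) \<le> n \<and> bits (cost ?I a) \<le> n"
    if "a \<in> {..<n + n}" for a
    using that assms by (auto simp: binary_instance_def intro!: bits_le power_strict_increasing)
  then have "2 * bits 2 + bits (cap1 ?I a) + bits (cap2 ?I a) + bits (cost ?I a) \<le> 4 + 3 * n"
    if "a \<in> {..<n + n}" for a
    using b that by fastforce
  from sum_bounded_above[of "{..<n + n}", OF this]
  have "(\<Sum>a<n + n. 2 * bits 2 + bits (cap1 ?I a) + bits (cap2 ?I a) + bits (cost ?I a))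
      \<le> (n + n) * (4 + 3 * n)"
    by simp
  moreover have "bits (budget ?I) \<le> n"
    using assms by (intro bits_le) (auto simp: binary_instance_def)
  moreover have "card (verts (graph ?I)) = 2" "arcs (graph ?I) = {..<n + n}"
    by (auto simp: binary_instance_def)
  ultimately show ?thesis
    using b by (simp add: encoding_length_def Let_def power2_eq_square algebra_simps)
qed

theorem theorem4:
  shows "\<exists>(\<kappa> :: real) (p :: real poly) (I :: nat \<Rightarrow> (nat, nat) bmfni).
    \<kappa> > 0 \<and>
    (\<forall>n\<ge>1. bmfni_instance (I n) \<and>
       two_terminal_parallel (graph (I n)) (source (I n)) (sink (I n)) \<and>
       real (encoding_length (I n)) \<le> poly p (real n)) \<and>
    (\<exists>N. \<forall>n\<ge>N. n \<ge> 1 \<longrightarrow>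
       real (card (supported_nondominated_points (I n))) \<ge> 2 powr (\<kappa> * real n) \<and>
       real (card (nondominated_points (I n))) \<ge> 2 powr (\<kappa> * real n))"
proof (intro exI conjI allI impI)
  show "(1 :: real) > 0" by simp
next
  fix n :: nat assume "n \<ge> 1"
  then have "real (encoding_length (binary_instance n)) \<le> real (8 + 9 * n + 6 * n\<^sup>2)"
    by (simp only: of_nat_le_iff encoding_length_binary_instance)
  then show "real (encoding_length (binary_instance n)) \<le> poly [:8, 9, 6:] (real n)"
    by (simp add: power2_eq_square algebra_simps)
next
  fix n :: nat
  let ?I = "binary_instance n"
  have "real (2 ^ n) \<le> real (card (supported_nondominated_points ?I))"
    using card_supported_binary_instance by (simp only: of_nat_le_iff)
  then show supported: "2 powr (1 * real n) \<le> real (card (supported_nondominated_points ?I))"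
    by (simp add: powr_realpow)
  have "card (supported_nondominated_points ?I) \<le> card (nondominated_points ?I)"
    using finite_nondominated_points[OF binary_instance_parallel(1)]
    by (rule card_mono) (auto simp: supported_nondominated_points_def)
  with supported show "2 powr (1 * real n) \<le> real (card (nondominated_points ?I))"
    by linarith
qed (rule binary_instance_parallel)+

end
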